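(* Let $X$ be a complete metric space such that every nonempty open set $U\subseteq X$ has box-counting dimension $\overline{\dim}_B(U)>1$. Then every nonempty open set $U\subseteq X$ contains a compact subset $A\subseteq U$ such that $A$ has $1$-dimensional Hausdorff measure zero but fails to have zero length in $X$.
   Context: Upper box-counting dimension: for a metric space $X$ and $\varepsilon>0$, $N_\varepsilon(X)$ is the smallest cardinality of a cover of $X$ by subsets of diameter $\le\varepsilon$. If $X$ is not totally bounded, put $\overline{\dim}_B(X)=\infty$; if $X$ is totally bounded, put $\overline{\dim}_B(X)=\limsup_{\varepsilon\to+0}\frac{\ln N_\varepsilon(X)}{\ln(1/\varepsilon)}\in[0,\infty]$. Subsets are considered as metric subspaces. A graph is a pair $\Gamma=(V,E)$ of a (possibly infinite) set $V$ of vertices and a set $E$ of edges, each edge being a nonempty subset of $V$ of cardinality at most $2$. A subset $C\subseteq V$ is connected if any $x,y\in C$ are joined by a sequence $c_0=x,\dots,c_n=y$ in $C$ with $\{c_{i-1},c_i\}\in E$ for $1\le i\le n$; maximal connected subsets of $V$ are the connected components of $\Gamma$. A graph in a metric space $(X,d_X)$ is a graph with $V\subseteq X$; its total length is $\ell(\Gamma)=\sum_{\{x,y\}\in E}d_X(x,y)\in[0,\infty]$ (supremum of finite subsums if $E$ is infinite). A set $A\subseteq X$ has zero length in $X$ if for every $\varepsilon>0$ there is a graph $\Gamma=(V,E)$ in $X$ with finitely many connected components such that $A\subseteq\overline V$ (closure in $X$) and $\ell(\Gamma)<\varepsilon$. A subset $A$ of a metric space $X$ has $1$-dimensional Hausdorff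 measure zero if for every $\varepsilon>0$ there exist a countable set $C\subseteq X$ and a function $\epsilon:C\to(0,1]$ such that $\sum_{c\in C}\epsilon(c)<\varepsilon$ and $A\subseteq\bigcup_{c\in C}B(c,\epsilon(c))$, where $B(x,\delta)=\{y\in X:d_X(x,y)<\delta\}$. *)

theory Defs
  imports "HOL-Analysis.Analysis"
begin

section \<open>Upper box-counting dimension\<close>

text \<open>
  Boundedness is required explicitly because \<^const>\<open>diameter\<close> is a real supremum and has
  no meaningful value on unbounded sets. Only finite covers are considered, so the number is
  meaningful only for totally bounded \<open>S\<close>; it is not used otherwise.
\<close>

definition covering_number :: "real \<Rightarrow> 'a::metric_space set \<Rightarrow> nat" where
  "covering_number \<epsilon> S =
     (LEAST n. \<exists>\<C>. finite \<C> \<and> card \<C> = n \<and> \<Union>\<C> = S \<and>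
        (\<forall>C\<in>\<C>. bounded C \<and> diameter C \<le> \<epsilon>))"

definition upper_box_dim :: "'a::metric_space set \<Rightarrow> ereal" where
  "upper_box_dim S =
     (if totally_bounded S
      then Limsup (at_right 0)
             (\<lambda>\<epsilon>. ereal (ln (real (covering_number \<epsilon> S)) / ln (1 / \<epsilon>)))
      else \<infinity>)"

section \<open>Graphs, total length and sets of zero length\<close>

definition is_graph :: "'a set \<Rightarrow> 'a set set \<Rightarrow> bool" where
  "is_graph V E \<longleftrightarrow> (\<forall>e\<in>E. e \<subseteq> V \<and> e \<noteq> {} \<and> finite e \<and> card e \<le> 2)"

text \<open>The trivial path (\<open>n = 0\<close>) is allowed, so singletons are connected.\<close>

definition graph_connected :: "'a set set \<Rightarrow> 'a set \<Rightarrow> bool" where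
  "graph_connected E C \<longleftrightarrow>
     (\<forall>x\<in>C. \<forall>y\<in>C. \<exists>(n::nat) c. c 0 = x \<and> c n = y \<and>
        (\<forall>i\<le>n. c i \<in> C) \<and> (\<forall>i\<in>{1..n}. {c (i - 1), c i} \<in> E))"

definition graph_components :: "'a set \<Rightarrow> 'a set set \<Rightarrow> 'a set set" where
  "graph_components V E =
     {C. C \<subseteq> V \<and> graph_connected E C \<and>
         (\<forall>D. C \<subseteq> D \<and> D \<subseteq> V \<and> graph_connected E D \<longrightarrow> D = C)}"

text \<open>
  The length of an edge \<open>{x, y}\<close> is its diameter, see \<open>diameter_edge\<close> below. In
  \<^typ>\<open>ennreal\<close> every \<^const>\<open>infsum\<close> exists and is the supremum of the
  finite subsums, see \<open>graph_length_eq_SUP\<close>.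
\<close>

definition graph_length :: "'a::metric_space set set \<Rightarrow> ennreal" where
  "graph_length E = (\<Sum>\<^sub>\<infinity>e\<in>E. ennreal (diameter e))"

lemma diameter_edge: "diameter {x, y} = dist x y" for x y :: "'a::metric_space"
proof -
  have "(\<lambda>(x, y). dist x y) ` ({x, y} \<times> {x, y}) = {0, dist x y}"
    by (auto simp: dist_commute)
  then show ?thesis
    by (simp add: diameter_def cSup_eq_Max)
qed

lemma graph_length_eq_SUP:
  "graph_length E = (SUP F\<in>{F. finite F \<and> F \<subseteq> E}. \<Sum>e\<in>F. ennreal (diameter e))"
  unfolding graph_length_def by (rule nonneg_infsum_complete) simp

definition zero_length :: "'a::metric_space set \<Rightarrow> bool" where
  "zero_length A \<longleftrightarrow>
     (\<forall>\<epsilon>>0. \<exists>V E. is_graph V E \<and> finite (graph_components V E) \<and>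
        A \<subseteq> closure V \<and> graph_length E < ennreal \<epsilon>)"

section \<open>One-dimensional Hausdorff measure zero\<close>

definition hausdorff1_null :: "'a::metric_space set \<Rightarrow> bool" where
  "hausdorff1_null A \<longleftrightarrow>
     (\<forall>\<epsilon>>0. \<exists>C r. countable C \<and> (\<forall>c\<in>C. 0 < r c \<and> r c \<le> 1) \<and>
        (\<Sum>\<^sub>\<infinity>c\<in>C. ennreal (r c)) < ennreal \<epsilon> \<and>
        A \<subseteq> (\<Union>c\<in>C. ball c (r c)))"

end

theory Submission
  imports Defs
begin

text \<open>
  A countable set suffices, namely a point \<open>x\<close> of \<open>U\<close> together with finite sets
  \<open>G\<^sub>0, G\<^sub>1, \<dots>\<close> that shrink to \<open>x\<close>. Such a set is compact, and being countable it has
  one-dimensional Hausdorff measure zero. The failure of zero length comes from the dimension.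

  Upper box dimension above 1 produces, for every \<open>K\<close>, a finite \<open>d\<close>-separated set with at least
  \<open>K\<close> points whose number times \<open>d\<close> is also at least \<open>K\<close> (\<open>large_separated_set\<close>). The
  hypothesis holds for every neighbourhood of \<open>x\<close>, so \<open>G\<^sub>k\<close> can be taken in \<open>U\<close> within
  distance \<open>1 / (k + 1)\<close> of \<open>x\<close>, and with \<open>K\<close> growing with \<open>k\<close>.

  Suppose that a graph with \<open>m\<close> components has vertices near all points of a \<open>d\<close>-separated set
  with \<open>n\<close> points. The balls of radius \<open>d / 2\<close> around these points are disjoint, so at most
  \<open>m\<close> of them contain an entire component; in each of the other balls some component comes close
  to the centre and also leaves the ball, which costs length comparable to \<open>d\<close>. The
  total length is therefore at least a constant times \<open>(n - m) d\<close>
  (\<open>graph_length_lower_bound\<close>). Once \<open>n \<ge> 2 m\<close>, which holds for \<open>G\<^sub>k\<close> when \<open>k\<close> is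
  large, this is comparable to \<open>n d\<close> and hence bounded below by a constant.
  Allowing any finite number of components therefore does not help the graph, since that number
  is fixed before \<open>k\<close> is chosen.
\<close>

section \<open>Large separated sets\<close>

text \<open>Greedy choice: a separated set with fewer than \<open>N\<close> points does not yet cover \<open>S\<close> by
  its balls, so it can be extended.\<close>

lemma separated_set_exists:
  fixes S :: "'a::metric_space set"
  assumes "d > 0"
    and "\<And>H. \<lbrakk>finite H; H \<subseteq> S; card H < N\<rbrakk> \<Longrightarrow> \<not> S \<subseteq> (\<Union>h\<in>H. ball h d)"
  shows "\<exists>G. finite G \<and> G \<subseteq> S \<and> card G = N \<and> (\<forall>x\<in>G. \<forall>y\<in>G. x \<noteq> y \<longrightarrow> d \<le> dist x y)"
proof -
  have "\<exists>G. finite G \<and> G \<subseteq> S \<and> card G = n \<and> (\<forall>x\<in>G. \<forall>y\<in>G. x \<noteq> y \<longrightarrow> d \<le> dist x y)"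
    if "n \<le> N" for n
    using that
  proof (induction n)
    case 0
    show ?case by (rule exI[of _ "{}"]) simp
  next
    case (Suc n)
    then obtain G where G: "finite G" "G \<subseteq> S" "card G = n"
      "\<forall>x\<in>G. \<forall>y\<in>G. x \<noteq> y \<longrightarrow> d \<le> dist x y"
      by auto
    with Suc.prems assms(2)[of G] obtain x where x: "x \<in> S" "\<forall>g\<in>G. d \<le> dist g x"
      by (auto simp: subset_eq not_less)
    moreover have "x \<notin> G"
      using x(2) \<open>d > 0\<close> by force
    moreover have "d \<le> dist x g" if "g \<in> G" for g
      using x(2) that by (simp add: dist_commute)
    ultimately show ?case
      using G by (intro exI[of _ "insert x G"]) auto
  qed
  then show ?thesis by blast
qed

lemma covering_number_le:
  assumes "finite H" "S \<subseteq> (\<Union>h\<in>H. ball h d)" "d > 0"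
  shows "covering_number (2 * d) S \<le> card H"
proof -
  let ?C = "(\<lambda>h. S \<inter> ball h d) ` H"
  have "diameter (S \<inter> ball h d) \<le> 2 * d" for h
  proof (cases "S \<inter> ball h d = {}")
    case False
    have "dist x y \<le> 2 * d" if "x \<in> ball h d" "y \<in> ball h d" for x y
      using that dist_triangle3[of x y h] by simp
    with False show ?thesis
      unfolding diameter_def by (auto intro!: cSUP_least)
  qed (use \<open>d > 0\<close> in simp)
  moreover have "\<Union>?C = S"
    using assms(2) by blast
  moreover have "bounded (S \<inter> ball h d)" for h
    by (meson bounded_ball bounded_subset inf_le2)
  ultimately have "covering_number (2 * d) S \<le> card ?C"
    unfolding covering_number_def using \<open>finite H\<close> by (intro Least_le exI[of _ ?C]) auto
  also have "\<dots> \<le> card H"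
    by (rule card_image_le) fact
  finally show ?thesis .
qed

text \<open>Dimension above some \<open>c > 1\<close> means that the covering number exceeds \<open>\<epsilon>\<close> to the power
  \<open>- c\<close> for arbitrarily small \<open>\<epsilon>\<close>, and \<open>\<epsilon>\<close> to the power \<open>1 - c\<close> is unbounded.\<close>

lemma large_covering_number:
  assumes "totally_bounded S" "upper_box_dim S > 1"
  shows "\<exists>\<epsilon>. 0 < \<epsilon> \<and> \<epsilon> < 1 \<and> M \<le> real (covering_number \<epsilon> S) * \<epsilon>"
proof -
  let ?N = "\<lambda>\<epsilon>. real (covering_number \<epsilon> S)"
  have "1 < Limsup (at_right 0) (\<lambda>\<epsilon>. ereal (ln (?N \<epsilon>) / ln (1 / \<epsilon>)))"
    using assms by (simp add: upper_box_dim_def)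
  then obtain c where c: "1 < ereal c"
    and lim: "ereal c < Limsup (at_right 0) (\<lambda>\<epsilon>. ereal (ln (?N \<epsilon>) / ln (1 / \<epsilon>)))"
    using ereal_dense2 by blast
  have "c > 1" using c by simp
  define M' where "M' = max 1 M"
  have "\<exists>\<^sub>F \<epsilon> in at_right 0. c < ln (?N \<epsilon>) / ln (1 / \<epsilon>)"
  proof (rule ccontr)
    assume "\<not> ?thesis"
    then have "\<forall>\<^sub>F \<epsilon> in at_right 0. ereal (ln (?N \<epsilon>) / ln (1 / \<epsilon>)) \<le> ereal c"
      by (simp add: not_frequently not_less)
    from Limsup_bounded[OF this] lim show False by simp
  qed
  \<comment> \<open>The second bound on \<open>\<epsilon>\<close> says that \<open>\<epsilon>\<close> to the power \<open>1 - c\<close> exceeds \<open>M'\<close>.\<close>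
  moreover have "\<forall>\<^sub>F \<epsilon> in at_right 0. \<epsilon> \<in> {0<..<min 1 (exp (- ln M' / (c - 1)))}"
    by (rule eventually_at_right_real) simp
  ultimately have "\<exists>\<^sub>F \<epsilon> in at_right 0. \<epsilon> \<in> {0<..<min 1 (exp (- ln M' / (c - 1)))} \<and>
      c < ln (?N \<epsilon>) / ln (1 / \<epsilon>)"
    by (rule frequently_eventually_conj)
  then obtain \<epsilon> where "\<epsilon> \<in> {0<..<min 1 (exp (- ln M' / (c - 1)))}"
      "c < ln (?N \<epsilon>) / ln (1 / \<epsilon>)"
    using frequently_ex by blast
  then have \<epsilon>: "c < ln (?N \<epsilon>) / ln (1 / \<epsilon>)"
      "0 < \<epsilon>" "\<epsilon> < 1" "\<epsilon> < exp (- ln M' / (c - 1))"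
    by simp_all
  define L where "L = ln (1 / \<epsilon>)"
  have L: "L = - ln \<epsilon>" "L > 0"
    using \<epsilon> by (auto simp: L_def ln_div)
  have "ln \<epsilon> < - ln M' / (c - 1)"
    using \<epsilon> by (metis exp_less_cancel_iff exp_ln)
  then have M: "ln M' < (c - 1) * L"
    using \<open>c > 1\<close> L by (simp add: field_simps)
  have N: "c * L < ln (?N \<epsilon>)"
    using \<epsilon>(1) L(2) by (simp add: L_def[symmetric] field_simps)
  moreover have "c * L > 0" using \<open>c > 1\<close> L(2) by simp
  ultimately have "?N \<epsilon> > 0"
    by (metis ln_0 less_asym less_trans of_nat_0_le_iff order_le_less)
  have "ln M' < ln (?N \<epsilon> * \<epsilon>)"
    using \<open>?N \<epsilon> > 0\<close> \<epsilon>(2) M N L(1) by (simp add: ln_mult algebra_simps)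
  then have "M' < ?N \<epsilon> * \<epsilon>"
    using \<open>?N \<epsilon> > 0\<close> \<epsilon>(2) by (simp add: M'_def)
  then show ?thesis
    using \<epsilon> by (intro exI[of _ \<epsilon>]) (auto simp: M'_def)
qed

text \<open>In a set that is not totally bounded, some scale \<open>d\<close> admits separated sets of every
  size; \<open>d\<close> then cannot be made small, which is why the two lower bounds are stated separately.\<close>

lemma large_separated_set:
  fixes S :: "'a::metric_space set"
  assumes "upper_box_dim S > 1"
  shows "\<exists>G d. d > 0 \<and> finite G \<and> G \<subseteq> S \<and> (\<forall>x\<in>G. \<forall>y\<in>G. x \<noteq> y \<longrightarrow> d \<le> dist x y) \<and>
           K \<le> real (card G) \<and> K \<le> real (card G) * d"
proof (cases "totally_bounded S")
  case True
  obtain \<epsilon> where \<epsilon>: "0 < \<epsilon>" "\<epsilon> < 1" "2 * K \<le> real (covering_number \<epsilon> S) * \<epsilon>"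
    using large_covering_number[OF True assms] by blast
  obtain G where G: "finite G" "G \<subseteq> S" "card G = covering_number \<epsilon> S"
      "\<forall>x\<in>G. \<forall>y\<in>G. x \<noteq> y \<longrightarrow> \<epsilon> / 2 \<le> dist x y"
    using separated_set_exists[of "\<epsilon> / 2" S "covering_number \<epsilon> S"]
      covering_number_le[of _ S "\<epsilon> / 2"] \<epsilon>(1) by fastforce
  have "real (card G) * (\<epsilon> / 2) \<le> real (card G) * 1"
    using \<epsilon> by (intro mult_left_mono) auto
  then show ?thesis
    using G \<epsilon> by (intro exI[of _ G] exI[of _ "\<epsilon> / 2"]) auto
next
  case False
  then obtain d where d: "d > 0" "\<And>H. finite H \<Longrightarrow> \<not> S \<subseteq> (\<Union>h\<in>H. ball h d)"
    unfolding totally_bounded_metric ball_def by blast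
  define N where "N = nat \<lceil>max K (K / d)\<rceil>"
  obtain G where G: "finite G" "G \<subseteq> S" "card G = N"
      "\<forall>x\<in>G. \<forall>y\<in>G. x \<noteq> y \<longrightarrow> d \<le> dist x y"
    using separated_set_exists[of d S N] d by blast
  have "max K (K / d) \<le> real N"
    unfolding N_def by (rule real_nat_ceiling_ge)
  then have "K \<le> real N" "K \<le> real N * d"
    using d(1) by (auto simp: field_simps)
  then show ?thesis
    using G d(1) by (intro exI[of _ G] exI[of _ d]) auto
qed

section \<open>Length of graphs near a separated set\<close>

lemma graph_connected_iff:
  "graph_connected E C \<longleftrightarrow>
     (\<forall>x\<in>C. \<forall>y\<in>C. (x, y) \<in> {(x, y). x \<in> C \<and> y \<in> C \<and> {x, y} \<in> E}\<^sup>*)" (is "_ \<longleftrightarrow> (\<forall>x\<in>C. \<forall>y\<in>C. (x, y) \<in> ?R\<^sup>*)")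
proof -
  have "(\<exists>(n::nat) c. c 0 = x \<and> c n = y \<and> (\<forall>i\<le>n. c i \<in> C) \<and> (\<forall>i\<in>{1..n}. {c (i - 1), c i} \<in> E))
      \<longleftrightarrow> (x, y) \<in> ?R\<^sup>*" (is "?L \<longleftrightarrow> _") if "x \<in> C" "y \<in> C" for x y
  proof
    assume ?L
    then obtain n c where c: "c 0 = x" "c n = y" "\<forall>i\<le>n. c i \<in> C"
      "\<forall>i\<in>{1..n::nat}. {c (i - 1), c i} \<in> E"
      by blast
    have "(c i, c (Suc i)) \<in> ?R" if "i < n" for i
      using that c(3) c(4)[rule_format, of "Suc i"] by auto
    then have "(x, y) \<in> ?R ^^ n"
      using c unfolding relpow_fun_conv by blast
    then show "(x, y) \<in> ?R\<^sup>*"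
      by (rule relpow_imp_rtrancl)
  next
    assume "(x, y) \<in> ?R\<^sup>*"
    then obtain n where "(x, y) \<in> ?R ^^ n"
      using rtrancl_imp_relpow by blast
    then obtain c where c: "c 0 = x" "c n = y" "\<forall>i<n. (c i, c (Suc i)) \<in> ?R"
      unfolding relpow_fun_conv by blast
    have "c i \<in> C" if "i \<le> n" for i
      using that c \<open>y \<in> C\<close> by (cases "i = n") auto
    moreover have "{c (i - 1), c i} \<in> E" if "i \<in> {1..n}" for i
      using that c(3)[rule_format, of "i - 1"] by auto
    ultimately show ?L
      using c by blast
  qed
  then show ?thesis
    unfolding graph_connected_def by blast
qed

lemma in_graph_component:
  assumes "v \<in> V"
  obtains C where "C \<in> graph_components V E" "v \<in> C"
proof
  define \<D> where "\<D> = {D. D \<subseteq> V \<and> v \<in> D \<and> graph_connected E D}"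
  let ?R = "\<lambda>C. {(x, y). x \<in> C \<and> y \<in> C \<and> {x, y} \<in> E}"
  have "graph_connected E {v}"
    by (auto simp: graph_connected_iff)
  then show v: "v \<in> \<Union>\<D>"
    using assms by (auto simp: \<D>_def)
  have "(x, v) \<in> (?R (\<Union>\<D>))\<^sup>* \<and> (v, x) \<in> (?R (\<Union>\<D>))\<^sup>*" if "x \<in> D" "D \<in> \<D>" for x D
  proof -
    have "(x, v) \<in> (?R D)\<^sup>*" "(v, x) \<in> (?R D)\<^sup>*"
      using that by (auto simp: \<D>_def graph_connected_iff)
    moreover have "(?R D)\<^sup>* \<subseteq> (?R (\<Union>\<D>))\<^sup>*"
      using that(2) by (intro rtrancl_mono) auto
    ultimately show ?thesis by blast
  qed
  then have "graph_connected E (\<Union>\<D>)"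
    unfolding graph_connected_iff by (meson UnionE rtrancl_trans)
  moreover have "D = \<Union>\<D>" if "\<Union>\<D> \<subseteq> D" "D \<subseteq> V" "graph_connected E D" for D
  proof -
    have "D \<in> \<D>" using that v by (auto simp: \<D>_def)
    then show ?thesis using that(1) by blast
  qed
  ultimately show "\<Union>\<D> \<in> graph_components V E"
    by (auto simp: graph_components_def \<D>_def)
qed

text \<open>A path may traverse an edge several times, whereas the sum counts each edge once. The
  bound holds because the intervals spanned by the values of \<open>f\<close> on the edges cover all values
  between \<open>f (c n)\<close> and \<open>f (c 0)\<close>, and Lebesgue measure is subadditive.\<close>

lemma path_descent_le:
  fixes c :: "nat \<Rightarrow> 'a" and f :: "'a \<Rightarrow> real"
  assumes "finite F" "\<And>e. e \<in> F \<Longrightarrow> finite e" "\<And>i. i < n \<Longrightarrow> {c i, c (Suc i)} \<in> F"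
  shows "f (c 0) - f (c n) \<le> (\<Sum>e\<in>F. diameter (f ` e))"
proof -
  have bdd: "bounded (f ` e)" if "e \<in> F" for e
    using assms(2)[OF that] by (simp add: finite_imp_bounded)
  define I where "I e = {Min (f ` e)..Max (f ` e)}" for e
  define F' where "F' = {e\<in>F. e \<noteq> {}}"
  have "finite F'" using assms(1) by (simp add: F'_def)
  have fin: "finite e" "e \<noteq> {}" if "e \<in> F'" for e
    using that assms(2) by (auto simp: F'_def)
  have "{f (c n)..<f (c 0)} \<subseteq> (\<Union>e\<in>F'. I e)"
  proof
    fix t assume t: "t \<in> {f (c n)..<f (c 0)}"
    \<comment> \<open>The edge that enters the first vertex at height at most \<open>t\<close> spans \<open>t\<close>.\<close>
    define i where "i = (LEAST i. f (c i) \<le> t)"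
    have i: "f (c i) \<le> t" "i \<le> n"
      unfolding i_def using t by (auto intro: LeastI Least_le)
    have "i \<noteq> 0"
    proof
      assume "i = 0"
      with i(1) t show False by simp
    qed
    then obtain j where j: "i = Suc j" using not0_implies_Suc by blast
    have "t < f (c j)"
      using not_less_Least[of j "\<lambda>i. f (c i) \<le> t"] j by (simp add: i_def)
    moreover have "{c j, c (Suc j)} \<in> F'"
      using assms(3)[of j] i j by (simp add: F'_def)
    ultimately show "t \<in> (\<Union>e\<in>F'. I e)"
      using i j by (intro UN_I[of "{c j, c (Suc j)}"]) (auto simp: I_def)
  qed
  then have "emeasure lborel {f (c n)..<f (c 0)} \<le> emeasure lborel (\<Union>e\<in>F'. I e)"
    using \<open>finite F'\<close> by (intro emeasure_mono) (auto simp: I_def)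
  also have "\<dots> \<le> (\<Sum>e\<in>F'. emeasure lborel (I e))"
    using \<open>finite F'\<close> by (intro emeasure_subadditive_finite) (auto simp: I_def)
  also have "\<dots> \<le> (\<Sum>e\<in>F'. ennreal (diameter (f ` e)))"
  proof (rule sum_mono)
    fix e assume e: "e \<in> F'"
    have "Max (f ` e) \<in> f ` e" "Min (f ` e) \<in> f ` e"
      using fin[OF e] by auto
    then have "Max (f ` e) - Min (f ` e) \<le> diameter (f ` e)"
      using diameter_bounded_bound[OF bdd, of e "Max (f ` e)" "Min (f ` e)"] e
      by (auto simp: F'_def dist_real_def)
    moreover have "Min (f ` e) \<le> Max (f ` e)"
      using fin[OF e] by simp
    ultimately show "emeasure lborel (I e) \<le> ennreal (diameter (f ` e))"
      by (simp add: I_def ennreal_leI)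
  qed
  also have "\<dots> \<le> (\<Sum>e\<in>F. ennreal (diameter (f ` e)))"
    using assms(1) by (intro sum_mono2) (auto simp: F'_def)
  also have "\<dots> = ennreal (\<Sum>e\<in>F. diameter (f ` e))"
    using bdd by (intro sum_ennreal) (simp add: diameter_ge_0)
  finally have *: "emeasure lborel {f (c n)..<f (c 0)} \<le> ennreal (\<Sum>e\<in>F. diameter (f ` e))" .
  have nonneg: "0 \<le> (\<Sum>e\<in>F. diameter (f ` e))"
    using bdd by (intro sum_nonneg) (simp add: diameter_ge_0)
  show ?thesis
  proof (cases "f (c n) \<le> f (c 0)")
    case True
    with * nonneg show ?thesis by (simp add: ennreal_le_iff)
  qed (use nonneg in linarith)
qed

text \<open>The cones \<open>max 0 (r - dist y z)\<close> are 1-Lipschitz with disjoint supports, so each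
  endpoint of an edge lies in the support of at most one of them. They localize length:
  the oscillations along an edge can be added up over \<open>y\<close> although the edge may run from one
  ball to another.\<close>

lemma sum_cone_diameter_le:
  fixes G :: "'a::metric_space set"
  assumes "finite G" "\<And>x y. \<lbrakk>x \<in> G; y \<in> G; x \<noteq> y\<rbrakk> \<Longrightarrow> 2 * r \<le> dist x y"
  shows "(\<Sum>y\<in>G. diameter ((\<lambda>z. max 0 (r - dist y z)) ` {a, b})) \<le> 2 * dist a b"
proof -
  have card_le: "card {y\<in>G. dist y a < r} \<le> 1" for a
  proof (rule ccontr)
    assume "\<not> ?thesis"
    then obtain x y where xy: "x \<in> G" "dist x a < r" "y \<in> G" "dist y a < r" "x \<noteq> y"
      using card_le_Suc0_iff_eq[of "{y\<in>G. dist y a < r}"] \<open>finite G\<close> by auto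
    with assms(2)[of x y] dist_triangle2[of x y a] show False by simp
  qed
  have "diameter ((\<lambda>z. max 0 (r - dist y z)) ` {a, b})
      \<le> dist a b * ((if dist y a < r then 1 else 0) + (if dist y b < r then 1 else 0))" for y
  proof -
    have "\<bar>max 0 (r - dist y a) - max 0 (r - dist y b)\<bar> \<le> dist a b"
      using abs_dist_diff_le[of a y b] by (simp add: dist_commute)
    then show ?thesis
      by (auto simp: diameter_edge dist_real_def)
  qed
  then have "(\<Sum>y\<in>G. diameter ((\<lambda>z. max 0 (r - dist y z)) ` {a, b}))
      \<le> (\<Sum>y\<in>G. dist a b * ((if dist y a < r then 1 else 0) + (if dist y b < r then 1 else 0)))"
    by (rule sum_mono)
  also have "\<dots> = dist a b * (real (card {y\<in>G. dist y a < r}) + real (card {y\<in>G. dist y b < r}))"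
    using \<open>finite G\<close>
    by (simp add: sum_distrib_left[symmetric] sum.distrib sum.If_cases Int_def)
  also have "\<dots> \<le> dist a b * 2"
    using card_le[of a] card_le[of b] by (intro mult_left_mono) auto
  finally show ?thesis by simp
qed

lemma graph_length_lower_bound:
  fixes G :: "'a::metric_space set"
  assumes fin: "finite (graph_components V E)" and "finite G" and "G \<subseteq> closure V"
    and sep: "\<And>x y. \<lbrakk>x \<in> G; y \<in> G; x \<noteq> y\<rbrakk> \<Longrightarrow> d \<le> dist x y" and "d > 0"
  shows "ennreal ((real (card G) - real (card (graph_components V E))) * d / 8) \<le> graph_length E"
proof -
  let ?K = "graph_components V E"
  have "\<exists>v\<in>V. dist y v < d / 4" if "y \<in> G" for y
    using that \<open>G \<subseteq> closure V\<close> \<open>d > 0\<close> closure_approachable[of y V]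
    by (metis dist_commute divide_pos_pos subset_eq zero_less_numeral)
  then obtain v where v: "\<And>y. y \<in> G \<Longrightarrow> v y \<in> V" "\<And>y. y \<in> G \<Longrightarrow> dist y (v y) < d / 4"
    by metis
  have "\<exists>C\<in>?K. v y \<in> C" if "y \<in> G" for y
    using v(1)[OF that] in_graph_component by metis
  then obtain C where C: "\<And>y. y \<in> G \<Longrightarrow> C y \<in> ?K" "\<And>y. y \<in> G \<Longrightarrow> v y \<in> C y"
    by metis
  \<comment> \<open>Around the points of \<open>B\<close> the component may have no length at all; each such component
    lies in a single ball, so there are no more of these points than components.\<close>
  define B where "B = {y\<in>G. C y \<subseteq> ball y (d / 2)}"
  have "inj_on C B"
  proof (rule inj_onI, rule ccontr)
    fix x y assume xy: "x \<in> B" "y \<in> B" "C x = C y" "x \<noteq> y"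
    then have "dist x (v x) < d / 2" "dist y (v x) < d / 2"
      using C(2)[of x] by (auto simp: B_def subset_eq)
    with sep[of x y] xy dist_triangle2[of x y "v x"] show False
      by (simp add: B_def)
  qed
  then have "card B \<le> card ?K"
    using C(1) fin by (intro card_inj_on_le[of C]) (auto simp: B_def)
  moreover have "card (G - B) = card G - card B" "card B \<le> card G"
    using \<open>finite G\<close> by (auto simp: B_def intro: card_Diff_subset card_mono)
  ultimately have card: "real (card G) - real (card ?K) \<le> real (card (G - B))"
    by simp
  have "\<exists>n c. c 0 = v y \<and> d / 2 \<le> dist y (c n) \<and> (\<forall>i<n. {c i, c (Suc i)} \<in> E)"
    if y: "y \<in> G - B" for y
  proof -
    obtain w where w: "w \<in> C y" "d / 2 \<le> dist y w"
      using y by (auto simp: B_def subset_eq not_less)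
    have "graph_connected E (C y)"
      using C(1)[of y] y by (simp add: graph_components_def)
    then obtain n c where "c 0 = v y" "c n = w" "\<forall>i\<in>{1..n::nat}. {c (i - 1), c i} \<in> E"
      using w(1) C(2)[of y] y unfolding graph_connected_def by blast
    moreover from this have "{c i, c (Suc i)} \<in> E" if "i < n" for i
      using that by force
    ultimately show ?thesis using w(2) by blast
  qed
  then obtain n c where c: "\<And>y. y \<in> G - B \<Longrightarrow> c y 0 = v y"
    "\<And>y. y \<in> G - B \<Longrightarrow> d / 2 \<le> dist y (c y (n y))"
    "\<And>y i. y \<in> G - B \<Longrightarrow> i < n y \<Longrightarrow> {c y i, c y (Suc i)} \<in> E"
    by metis
  define F where "F = (\<Union>y\<in>G - B. (\<lambda>i. {c y i, c y (Suc i)}) ` {..<n y})"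
  have F: "finite F" "F \<subseteq> E"
    using \<open>finite G\<close> c(3) by (auto simp: F_def)
  define \<phi> where "\<phi> y z = max 0 (d / 2 - dist y z)" for y z :: 'a
  have "real (card (G - B)) * (d / 4) \<le> (\<Sum>y\<in>G - B. \<Sum>e\<in>F. diameter (\<phi> y ` e))"
  proof (rule sum_bounded_below)
    fix y assume y: "y \<in> G - B"
    have "d / 4 \<le> \<phi> y (c y 0) - \<phi> y (c y (n y))"
    proof -
      have "\<phi> y (c y (n y)) = 0"
        using c(2)[OF y] by (simp add: \<phi>_def)
      moreover have "d / 2 - dist y (v y) \<le> \<phi> y (c y 0)"
        using c(1)[OF y] by (simp add: \<phi>_def)
      moreover have "dist y (v y) < d / 4"
        using v(2) y by blast
      ultimately show ?thesis by linarith
    qed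
    also have "\<dots> \<le> (\<Sum>e\<in>F. diameter (\<phi> y ` e))"
      using F y by (intro path_descent_le) (auto simp: F_def)
    finally show "d / 4 \<le> (\<Sum>e\<in>F. diameter (\<phi> y ` e))" .
  qed
  also have "\<dots> = (\<Sum>e\<in>F. \<Sum>y\<in>G - B. diameter (\<phi> y ` e))"
    by (rule sum.swap)
  also have "\<dots> \<le> (\<Sum>e\<in>F. 2 * diameter e)"
  proof (rule sum_mono)
    fix e assume "e \<in> F"
    then obtain a b where "e = {a, b}" by (auto simp: F_def)
    then show "(\<Sum>y\<in>G - B. diameter (\<phi> y ` e)) \<le> 2 * diameter e"
      using sum_cone_diameter_le[of "G - B" "d / 2" a b] sep \<open>finite G\<close>
      by (simp add: \<phi>_def diameter_edge)
  qed
  finally have "real (card (G - B)) * d / 8 \<le> (\<Sum>e\<in>F. diameter e)"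
    by (simp add: sum_distrib_left[symmetric])
  moreover have "(real (card G) - real (card ?K)) * d \<le> real (card (G - B)) * d"
    using card \<open>d > 0\<close> by (intro mult_right_mono) auto
  ultimately have "ennreal ((real (card G) - real (card ?K)) * d / 8) \<le> ennreal (\<Sum>e\<in>F. diameter e)"
    by (intro ennreal_leI) simp
  also have "\<dots> = (\<Sum>e\<in>F. ennreal (diameter e))"
    by (rule sum_ennreal[symmetric]) (auto simp: F_def diameter_edge)
  also have "\<dots> \<le> graph_length E"
    unfolding graph_length_eq_SUP using F by (intro SUP_upper) auto
  finally show ?thesis .
qed

section \<open>Countable compact sets of Hausdorff measure zero\<close>

lemma countable_imp_hausdorff1_null:
  assumes "countable A"
  shows "hausdorff1_null A"
  unfolding hausdorff1_null_def
proof (intro allI impI)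
  fix \<epsilon> :: real assume "\<epsilon> > 0"
  define \<delta> where "\<delta> = min 1 (\<epsilon> / 2)"
  have \<delta>: "0 < \<delta>" "\<delta> \<le> 1" "\<delta> < \<epsilon>"
    using \<open>\<epsilon> > 0\<close> by (auto simp: \<delta>_def)
  define r where "r x = \<delta> * (1 / 2) ^ Suc (to_nat_on A x)" for x
  have "(\<Sum>\<^sub>\<infinity>x\<in>A. ennreal (r x)) \<le> ennreal \<delta>"
  proof (rule infsum_le_finite_sums)
    fix F assume F: "finite F" "F \<subseteq> A"
    have "(\<Sum>x\<in>F. r x) = (\<Sum>n\<in>to_nat_on A ` F. \<delta> * (1 / 2) ^ Suc n)"
      using inj_on_subset[OF inj_on_to_nat_on[OF assms] F(2)] by (simp add: sum.reindex r_def)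
    also have "\<dots> \<le> (\<Sum>n. \<delta> * (1 / 2) ^ Suc n)"
      using F(1) \<delta>(1) sums_mult[OF power_half_series, of \<delta>]
      by (intro sum_le_suminf) (auto simp: sums_iff)
    also have "\<dots> = \<delta>"
      using sums_mult[OF power_half_series, of \<delta>] by (simp add: sums_iff)
    finally show "(\<Sum>x\<in>F. ennreal (r x)) \<le> ennreal \<delta>"
      using \<delta>(1) by (subst sum_ennreal) (auto simp: r_def intro!: ennreal_leI)
  qed (simp add: nonneg_summable_on_complete)
  also have "\<dots> < ennreal \<epsilon>"
    using \<delta> by (simp add: ennreal_lessI)
  finally have "(\<Sum>\<^sub>\<infinity>x\<in>A. ennreal (r x)) < ennreal \<epsilon>" .
  moreover have "0 < r x" "r x \<le> 1" for x
    using \<delta> by (auto simp: r_def intro!: mult_le_one power_le_one simp del: power_Suc)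
  ultimately show "\<exists>C r. countable C \<and> (\<forall>c\<in>C. 0 < r c \<and> r c \<le> 1) \<and>
      (\<Sum>\<^sub>\<infinity>c\<in>C. ennreal (r c)) < ennreal \<epsilon> \<and> A \<subseteq> (\<Union>c\<in>C. ball c (r c))"
    using assms by (intro exI[of _ A] exI[of _ r]) auto
qed

lemma compact_insert_shrinking_finite:
  fixes x :: "'a::metric_space" and G :: "nat \<Rightarrow> 'a set"
  assumes "\<And>k. finite (G k)" "\<And>k. G k \<subseteq> ball x (1 / real (Suc k))"
  shows "compact (insert x (\<Union>k. G k))"
proof (rule compactI)
  fix \<C> assume \<C>: "\<forall>t\<in>\<C>. open t" "insert x (\<Union>k. G k) \<subseteq> \<Union>\<C>"
  then obtain T where T: "T \<in> \<C>" "x \<in> T" "open T" by blast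
  then obtain e where e: "e > 0" "ball x e \<subseteq> T"
    using open_contains_ball by blast
  obtain m where m: "1 / real (Suc m) < e"
    using nat_approx_posE[OF e(1)] by blast
  have sub: "G k \<subseteq> T" if "m \<le> k" for k
  proof -
    have "1 / real (Suc k) \<le> 1 / real (Suc m)"
      using that by (intro divide_left_mono) auto
    with m have "ball x (1 / real (Suc k)) \<subseteq> ball x e"
      by (intro subset_ball) simp
    with assms(2) e(2) show ?thesis by blast
  qed
  have "compact (\<Union>k<m. G k)"
    using assms(1) by (intro finite_imp_compact) auto
  moreover have "(\<Union>k<m. G k) \<subseteq> \<Union>\<C>" using \<C>(2) by blast
  ultimately obtain \<D> where \<D>: "\<D> \<subseteq> \<C>" "finite \<D>" "(\<Union>k<m. G k) \<subseteq> \<Union>\<D>"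
    using compactE \<C>(1) by metis
  have "(\<Union>k. G k) \<subseteq> \<Union>(insert T \<D>)"
  proof
    fix y assume "y \<in> (\<Union>k. G k)"
    then obtain k where "y \<in> G k" by blast
    then show "y \<in> \<Union>(insert T \<D>)"
      using sub[of k] \<D>(3) by (cases "m \<le> k") (auto simp: not_le)
  qed
  then show "\<exists>\<C>'\<subseteq>\<C>. finite \<C>' \<and> insert x (\<Union>k. G k) \<subseteq> \<Union>\<C>'"
    using \<D> T by (intro exI[of _ "insert T \<D>"]) auto
qed

theorem mainTheorem4:
  assumes "\<And>U :: 'a::complete_space set. open U \<Longrightarrow> U \<noteq> {} \<Longrightarrow> upper_box_dim U > 1"
  shows "\<forall>U :: 'a set. open U \<and> U \<noteq> {} \<longrightarrow>
           (\<exists>A. A \<subseteq> U \<and> compact A \<and> hausdorff1_null A \<and> \<not> zero_length A)"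
proof (intro allI impI, elim conjE)
  fix U :: "'a set" assume U: "open U" "U \<noteq> {}"
  then obtain x where x: "x \<in> U" by blast
  \<comment> \<open>The bound 16 makes up for the factor 1/8 in the length bound and for the loss of at most
    half of the points to the components.\<close>
  have "\<exists>G d. d > 0 \<and> finite G \<and> G \<subseteq> U \<inter> ball x (1 / real (Suc k)) \<and>
      (\<forall>y\<in>G. \<forall>z\<in>G. y \<noteq> z \<longrightarrow> d \<le> dist y z) \<and>
      real (k + 16) \<le> real (card G) \<and> real (k + 16) \<le> real (card G) * d" for k
  proof (rule large_separated_set, rule assms)
    have "x \<in> U \<inter> ball x (1 / real (Suc k))" using x by simp
    then show "U \<inter> ball x (1 / real (Suc k)) \<noteq> {}" by blast
  qed (use U in auto)
  then obtain G d where d: "\<And>k. d k > 0"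
    and G: "\<And>k. finite (G k)" "\<And>k. G k \<subseteq> U \<inter> ball x (1 / real (Suc k))"
    and sep: "\<And>k y z. y \<in> G k \<Longrightarrow> z \<in> G k \<Longrightarrow> y \<noteq> z \<Longrightarrow> d k \<le> dist y z"
    and large: "\<And>k. real (k + 16) \<le> real (card (G k))"
      "\<And>k. real (k + 16) \<le> real (card (G k)) * d k"
    by metis
  define A where "A = insert x (\<Union>k. G k)"
  have "compact A"
    unfolding A_def using G by (intro compact_insert_shrinking_finite) auto
  moreover have "A \<subseteq> U"
    using x G(2) by (auto simp: A_def)
  moreover have "hausdorff1_null A"
    using G(1) by (intro countable_imp_hausdorff1_null) (auto simp: A_def intro: countable_finite)
  moreover have "\<not> zero_length A"
  proof
    assume "zero_length A"
    then obtain V E where VE: "finite (graph_components V E)" "A \<subseteq> closure V"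
        "graph_length E < ennreal 1"
      unfolding zero_length_def by (meson zero_less_one)
    define m where "m = card (graph_components V E)"
    define k where "k = 2 * m"
    have "real (card (G k)) \<le> 2 * (real (card (G k)) - real m)"
      using large(1)[of k] by (simp add: k_def)
    then have "real (card (G k)) * d k \<le> 2 * (real (card (G k)) - real m) * d k"
      using d[of k] by (intro mult_right_mono) auto
    then have "1 \<le> (real (card (G k)) - real m) * d k / 8"
      using large(2)[of k] by (simp add: algebra_simps)
    then have "ennreal 1 \<le> ennreal ((real (card (G k)) - real m) * d k / 8)"
      by (rule ennreal_leI)
    also have "\<dots> \<le> graph_length E"
      unfolding m_def
    proof (rule graph_length_lower_bound)
      show "G k \<subseteq> closure V"
        using VE(2) by (auto simp: A_def)
    qed (use VE(1) G(1) sep d in auto)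
    finally show False using VE(3) by simp
  qed
  ultimately show "\<exists>A. A \<subseteq> U \<and> compact A \<and> hausdorff1_null A \<and> \<not> zero_length A"
    by blast
qed

end
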